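(* Fix $\theta\in\mathcal B$ with $C^\theta\ge0$. Let $\mathrm{OPT}_{\mathrm{LP}}(\theta)$ and $\mathrm{OPT}_{\mathrm{IP}}(\theta)$ denote the optimal objective values of the LP relaxation of the fixed-$\theta$ MCKP and of the fixed-$\theta$ MCKP, respectively. Let $\bm{x}(\theta)$ be the round-down solution produced from the hull-greedy LP solution (without any optional post-processing). Then $$\mathrm{OPT}_{\mathrm{LP}}(\theta)-N(\bm{x}(\theta))\le\Delta V_{\max}^\theta,\qquad\text{and hence}\qquad \mathrm{OPT}_{\mathrm{IP}}(\theta)-N(\bm{x}(\theta))\le\Delta V_{\max}^\theta .$$
   Context: Data. There are items $i=1,\dots,n$. Item $i$ has a finite price menu $\mathcal X_i=\{x_{i,1},\dots,x_{i,m}\}\subset\mathbb R$, a reference price $a_i>0$, an exposure $\omega_i>0$, a nominal demand function $\hat g_i:\mathcal X_i\to\mathbb R_{>0}$ (monotone decreasing on the admissible range), and a relative tolerance $\sigma_i$. A margin target $\Delta>0$ and an integer budget $\Gamma\in\{0,1,\dots,n\}$ are given. The admissible menu $\mathcal X_i^{\mathrm{ad}}=\mathcal X_i\cap[(1-\sigma_i)a_i,(1+\sigma_i)a_i]$ is assumed nonempty. A variability parameter $\delta_i(x_i)$ is given with $0\le\delta_i(x_i)<\hat g_i(x_i)$ on $\mathcal X_i^{\mathrm{ad}}$. Write $N(\bm{x})=\sum_i\omega_i x_i\hat g_i(x_i)$. All option indices $j$ below range over admissible options of item $i$. Fixed-$\theta$ MCKP. Put $v_{ij}=\omega_i x_{i,j}\hat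 g_i(x_{i,j})$, $s_{ij}=\omega_i(x_{i,j}-\Delta a_i)\hat g_i(x_{i,j})$, $t_{ij}=\omega_i(x_{i,j}-\Delta a_i)\delta_i(x_{i,j})$, and $\mathcal B=\{0\}\cup\{|t_{ij}|: x_{i,j}\in\mathcal X_i^{\mathrm{ad}}\}$. For $\theta\in\mathcal B$ let $s^\theta_{ij}=s_{ij}-\max\{0,|t_{ij}|-\theta\}$, choose $j^\theta(i)\in\arg\max_j s^\theta_{ij}$, and set $c^\theta_{ij}=s^\theta_{i,j^\theta(i)}-s^\theta_{ij}\ge0$ and $C^\theta=\sum_i s^\theta_{i,j^\theta(i)}-\Gamma\theta$. The fixed-$\theta$ MCKP is: choose one admissible option $j(i)$ per item to maximize $\sum_i v_{i,j(i)}$ subject to $\sum_i c^\theta_{i,j(i)}\le C^\theta$. Its LP relaxation uses variables $z_{ij}\ge0$, $\sum_j z_{ij}=1$ for each $i$, with objective $\sum_{i,j}v_{ij}z_{ij}$ and constraint $\sum_{i,j}c^\theta_{ij}z_{ij}\le C^\theta$. Upper hulls. Let $\mathcal P_i^\theta=\{(c^\theta_{ij},v_{ij})\}_j$. Discard dominated points ($(c',v')$ is discarded if another point $(c,v)$ has $c\le c'$, $v\ge v'$; for equal costs only the largest value is kept). Let $\mathcal H_i^\theta=\{(c^{H,\theta}_{i,1},v^{H,\theta}_{i,1}),\dots,(c^{H,\theta}_{i,p_i},v^{H,\theta}_{i,p_i})\}$ be the vertices of the resulting upper hull (efficient concave upper frontier), ordered by strictly increasing cost. Every hull vertex is a menu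 point, i.e. corresponds to an admissible option. Let $\Delta c^{H,\theta}_{i,k}=c^{H,\theta}_{i,k+1}-c^{H,\theta}_{i,k}$ and $\rho^{H,\theta}_{i,k}=(v^{H,\theta}_{i,k+1}-v^{H,\theta}_{i,k})/\Delta c^{H,\theta}_{i,k}$ for $k=1,\dots,p_i-1$. Define $$\Delta V_{\max}^\theta=\max_i\max_{k=1,\dots,p_i-1}\big(v^{H,\theta}_{i,k+1}-v^{H,\theta}_{i,k}\big)\ge0,$$ with $\max_{k\in\emptyset}(\cdot)=0$ when $p_i=1$. Hull-greedy and round-down. Start with every item at its first hull vertex, and fill the hull segments $(i,k)$ in nonincreasing order of $\rho^{H,\theta}_{i,k}$, each up to length $\Delta c^{H,\theta}_{i,k}$, until the residual capacity $C^\theta-\sum_i c^{H,\theta}_{i,1}$ is exhausted (with at most one final fractional fill) or all segments are filled. This yields an LP solution in which at most one item is fractional, and a fractional item mixes two adjacent hull vertices $k,k+1$. The round-down solution moves the fractional item, if any, to vertex $k$ (the cheaper one) and leaves all other items at their hull vertices; $\bm{x}(\theta)$ is the corresponding price vector. *)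

theory Defs
  imports "HOL-Analysis.Analysis"
begin

section \<open>Pricing data\<close>

text \<open>Items are indexed by \<open>1..n\<close> and menu positions by \<open>1..m\<close>.\<close>

record pricing_data =
  num_items :: nat                          (* n *)
  menu_size :: nat                          (* m *)
  price :: "nat \<Rightarrow> nat \<Rightarrow> real"              (* x_{i,j} *)
  ref_price :: "nat \<Rightarrow> real"                 (* a_i *)
  exposure :: "nat \<Rightarrow> real"                  (* omega_i *)
  demand :: "nat \<Rightarrow> real \<Rightarrow> real"            (* g_i, nominal demand *)
  tolerance :: "nat \<Rightarrow> real"                 (* sigma_i *)
  margin :: real                            (* Delta *)
  budget :: nat                             (* Gamma *)
  variability :: "nat \<Rightarrow> real \<Rightarrow> real"       (* delta_i *)

abbreviation items :: "pricing_data \<Rightarrow> nat set" where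
  "items D \<equiv> {1..num_items D}"

definition menu :: "pricing_data \<Rightarrow> nat \<Rightarrow> real set" where
  "menu D i = price D i ` {1..menu_size D}"

definition adm_menu :: "pricing_data \<Rightarrow> nat \<Rightarrow> real set" where
  "adm_menu D i = menu D i \<inter>
     {(1 - tolerance D i) * ref_price D i .. (1 + tolerance D i) * ref_price D i}"

definition options :: "pricing_data \<Rightarrow> nat \<Rightarrow> nat set" where
  "options D i = {j \<in> {1..menu_size D}. price D i j \<in> adm_menu D i}"

definition valid_data :: "pricing_data \<Rightarrow> bool" where
  "valid_data D \<longleftrightarrow>
     num_items D \<ge> 1 \<and>
     (\<forall>i\<in>items D.
        ref_price D i > 0 \<and> exposure D i > 0 \<and>
        (\<forall>x\<in>menu D i. demand D i x > 0) \<and>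
        antimono_on (adm_menu D i) (demand D i) \<and>
        adm_menu D i \<noteq> {} \<and>
        (\<forall>x\<in>adm_menu D i. 0 \<le> variability D i x \<and> variability D i x < demand D i x)) \<and>
     margin D > 0 \<and>
     budget D \<le> num_items D"

definition nominal_revenue :: "pricing_data \<Rightarrow> (nat \<Rightarrow> real) \<Rightarrow> real" where
  "nominal_revenue D x = (\<Sum>i\<in>items D. exposure D i * x i * demand D i (x i))"


section \<open>The fixed-\<open>\<theta>\<close> multiple-choice knapsack problem\<close>

definition opt_value :: "pricing_data \<Rightarrow> nat \<Rightarrow> nat \<Rightarrow> real" where   (* v_ij *)
  "opt_value D i j = exposure D i * price D i j * demand D i (price D i j)"

definition slack :: "pricing_data \<Rightarrow> nat \<Rightarrow> nat \<Rightarrow> real" where   (* s_ij *)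
  "slack D i j = exposure D i * (price D i j - margin D * ref_price D i) * demand D i (price D i j)"

definition deviation :: "pricing_data \<Rightarrow> nat \<Rightarrow> nat \<Rightarrow> real" where   (* t_ij *)
  "deviation D i j =
     exposure D i * (price D i j - margin D * ref_price D i) * variability D i (price D i j)"

definition breakpoints :: "pricing_data \<Rightarrow> real set" where
  "breakpoints D = {0} \<union> {\<bar>deviation D i j\<bar> | i j. i \<in> items D \<and> j \<in> options D i}"

definition robust_slack :: "pricing_data \<Rightarrow> real \<Rightarrow> nat \<Rightarrow> nat \<Rightarrow> real" where
  "robust_slack D \<theta> i j = slack D i j - max 0 (\<bar>deviation D i j\<bar> - \<theta>)"

text \<open>The choice \<open>j\<^sup>\<theta>\<close> of a maximiser is not unique; it is kept as an explicit
  parameter \<open>b\<close> below.\<close>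

definition base_choice :: "pricing_data \<Rightarrow> real \<Rightarrow> (nat \<Rightarrow> nat) \<Rightarrow> bool" where
  "base_choice D \<theta> b \<longleftrightarrow>
     (\<forall>i\<in>items D. is_arg_max (robust_slack D \<theta> i) (\<lambda>j. j \<in> options D i) (b i))"

definition opt_cost :: "pricing_data \<Rightarrow> real \<Rightarrow> (nat \<Rightarrow> nat) \<Rightarrow> nat \<Rightarrow> nat \<Rightarrow> real" where
  "opt_cost D \<theta> b i j = robust_slack D \<theta> i (b i) - robust_slack D \<theta> i j"

definition capacity :: "pricing_data \<Rightarrow> real \<Rightarrow> (nat \<Rightarrow> nat) \<Rightarrow> real" where
  "capacity D \<theta> b = (\<Sum>i\<in>items D. robust_slack D \<theta> i (b i)) - real (budget D) * \<theta>"

definition ip_feasible :: "pricing_data \<Rightarrow> real \<Rightarrow> (nat \<Rightarrow> nat) \<Rightarrow> (nat \<Rightarrow> nat) \<Rightarrow> bool" where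
  "ip_feasible D \<theta> b j \<longleftrightarrow>
     (\<forall>i\<in>items D. j i \<in> options D i) \<and>
     (\<Sum>i\<in>items D. opt_cost D \<theta> b i (j i)) \<le> capacity D \<theta> b"

definition opt_ip :: "pricing_data \<Rightarrow> real \<Rightarrow> (nat \<Rightarrow> nat) \<Rightarrow> real" where
  "opt_ip D \<theta> b = Sup {\<Sum>i\<in>items D. opt_value D i (j i) | j. ip_feasible D \<theta> b j}"

definition lp_feasible ::
    "pricing_data \<Rightarrow> real \<Rightarrow> (nat \<Rightarrow> nat) \<Rightarrow> (nat \<Rightarrow> nat \<Rightarrow> real) \<Rightarrow> bool" where
  "lp_feasible D \<theta> b z \<longleftrightarrow>
     (\<forall>i\<in>items D. (\<forall>j\<in>options D i. z i j \<ge> 0) \<and> (\<Sum>j\<in>options D i. z i j) = 1) \<and>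
     (\<Sum>i\<in>items D. \<Sum>j\<in>options D i. opt_cost D \<theta> b i j * z i j) \<le> capacity D \<theta> b"

definition opt_lp :: "pricing_data \<Rightarrow> real \<Rightarrow> (nat \<Rightarrow> nat) \<Rightarrow> real" where
  "opt_lp D \<theta> b =
     Sup {\<Sum>i\<in>items D. \<Sum>j\<in>options D i. opt_value D i j * z i j | z. lp_feasible D \<theta> b z}"


section \<open>Upper hulls\<close>

text \<open>Points are pairs (cost, value).\<close>

definition undominated :: "(real \<times> real) set \<Rightarrow> (real \<times> real) set" where
  "undominated P = {p \<in> P. \<not> (\<exists>q\<in>P. q \<noteq> p \<and> fst q \<le> fst p \<and> snd q \<ge> snd p)}"

text \<open>The vertices of the convex hull that lie on its upper boundary; points in the relative
  interior of an edge of the frontier are not vertices.\<close>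

definition upper_hull_vertices :: "(real \<times> real) set \<Rightarrow> (real \<times> real) set" where
  "upper_hull_vertices E =
     {p. p extreme_point_of (convex hull E) \<and>
         (\<forall>y. (fst p, y) \<in> convex hull E \<longrightarrow> y \<le> snd p)}"

definition points :: "pricing_data \<Rightarrow> real \<Rightarrow> (nat \<Rightarrow> nat) \<Rightarrow> nat \<Rightarrow> (real \<times> real) set" where
  "points D \<theta> b i = (\<lambda>j. (opt_cost D \<theta> b i j, opt_value D i j)) ` options D i"

text \<open>The hull vertices by increasing cost. Lists start at index \<open>0\<close>, so position \<open>k\<close> holds the
  \<open>(k+1)\<close>-st vertex, and the segments of item \<open>i\<close> are the \<open>(i, k)\<close> with \<open>k + 1 < p\<^sub>i\<close>.\<close>

definition hull_list :: "pricing_data \<Rightarrow> real \<Rightarrow> (nat \<Rightarrow> nat) \<Rightarrow> nat \<Rightarrow> (real \<times> real) list" where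
  "hull_list D \<theta> b i =
     (THE ps. set ps = upper_hull_vertices (undominated (points D \<theta> b i)) \<and>
              sorted_wrt (\<lambda>p q. fst p < fst q) ps)"

lemma inj_on_fst_undominated: "inj_on fst (undominated P)"
  by (auto simp: inj_on_def undominated_def) (metis nle_le fst_conv snd_conv)

lemma finite_undominated: "finite P \<Longrightarrow> finite (undominated P)" by (simp add: undominated_def)

lemma upper_hull_vertices_subset: "upper_hull_vertices E \<subseteq> E"
  using extreme_point_of_convex_hull by (auto simp: upper_hull_vertices_def)

lemma hull_list_correct:
  "set (hull_list D \<theta> b i) = upper_hull_vertices (undominated (points D \<theta> b i))
  \<and> sorted_wrt (\<lambda>p q. fst p < fst q) (hull_list D \<theta> b i)"
proof -
  let ?V = "upper_hull_vertices (undominated (points D \<theta> b i))"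
  have fin: "finite ?V"
    by (rule finite_subset[OF upper_hull_vertices_subset]) (simp add: finite_undominated points_def options_def)
  have inj: "inj_on fst ?V" using inj_on_fst_undominated upper_hull_vertices_subset by (meson inj_on_subset)
  define l where "l = map (inv_into ?V fst) (sorted_list_of_set (fst ` ?V))"
  have m: "map fst l = sorted_list_of_set (fst ` ?V)"
    unfolding l_def map_map using fin by (intro map_idI) (auto simp: f_inv_into_f)
  have s: "set l = ?V" using fin inj by (auto simp: l_def image_image)
  have "sorted_wrt (<) (map fst l)" unfolding m by simp
  hence w: "sorted_wrt (\<lambda>p q. fst p < fst q) l" by (simp add: sorted_wrt_map)
  have u: "l' = l" if "set l' = ?V" "sorted_wrt (\<lambda>p q. fst p < fst q) l'" for l'
  proof -
    have "map fst l' = map fst l"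
      using that s w by (intro strict_sorted_equal) (auto simp: sorted_wrt_map)
    moreover have "inj_on fst (set l' \<union> set l)" using inj that s by simp
    ultimately show ?thesis by (simp add: inj_on_map_eq_map)
  qed
  show ?thesis unfolding hull_list_def
    by (rule theI[where P="\<lambda>ps. set ps = ?V \<and> sorted_wrt (\<lambda>p q. fst p < fst q) ps" and a=l]) (use s w u in blast)+
qed

definition seg_cost :: "pricing_data \<Rightarrow> real \<Rightarrow> (nat \<Rightarrow> nat) \<Rightarrow> nat \<times> nat \<Rightarrow> real" where
  "seg_cost D \<theta> b = (\<lambda>(i, k). fst (hull_list D \<theta> b i ! (k + 1)) - fst (hull_list D \<theta> b i ! k))"

definition seg_value :: "pricing_data \<Rightarrow> real \<Rightarrow> (nat \<Rightarrow> nat) \<Rightarrow> nat \<times> nat \<Rightarrow> real" where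
  "seg_value D \<theta> b = (\<lambda>(i, k). snd (hull_list D \<theta> b i ! (k + 1)) - snd (hull_list D \<theta> b i ! k))"

definition seg_slope :: "pricing_data \<Rightarrow> real \<Rightarrow> (nat \<Rightarrow> nat) \<Rightarrow> nat \<times> nat \<Rightarrow> real" where
  "seg_slope D \<theta> b e = seg_value D \<theta> b e / seg_cost D \<theta> b e"

definition max_jump :: "pricing_data \<Rightarrow> real \<Rightarrow> (nat \<Rightarrow> nat) \<Rightarrow> real" where
  "max_jump D \<theta> b =
     (MAX i\<in>items D.
        if length (hull_list D \<theta> b i) = 1 then 0
        else MAX k\<in>{k. k + 1 < length (hull_list D \<theta> b i)}. seg_value D \<theta> b (i, k))"


section \<open>Hull-greedy and round-down\<close>

definition segments :: "pricing_data \<Rightarrow> real \<Rightarrow> (nat \<Rightarrow> nat) \<Rightarrow> (nat \<times> nat) set" where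
  "segments D \<theta> b = {(i, k). i \<in> items D \<and> k + 1 < length (hull_list D \<theta> b i)}"

text \<open>Ties between slopes may be broken arbitrarily.\<close>

definition greedy_order :: "pricing_data \<Rightarrow> real \<Rightarrow> (nat \<Rightarrow> nat) \<Rightarrow> (nat \<times> nat) list \<Rightarrow> bool" where
  "greedy_order D \<theta> b es \<longleftrightarrow>
     distinct es \<and> set es = segments D \<theta> b \<and>
     sorted_wrt (\<lambda>e e'. seg_slope D \<theta> b e \<ge> seg_slope D \<theta> b e') es"

text \<open>\<open>fill len R es e\<close> is the length of \<open>e\<close> that is filled when the segments \<open>es\<close>, of
  lengths \<open>len\<close>, are filled in list order with residual capacity \<open>R\<close>.\<close>

fun fill :: "('e \<Rightarrow> real) \<Rightarrow> real \<Rightarrow> 'e list \<Rightarrow> 'e \<Rightarrow> real" where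
  "fill len R [] = (\<lambda>e. 0)"
| "fill len R (e # es) = (fill len (R - min (len e) R) es)(e := min (len e) R)"

definition filled_fraction ::
    "pricing_data \<Rightarrow> real \<Rightarrow> (nat \<Rightarrow> nat) \<Rightarrow> (nat \<times> nat) list \<Rightarrow> nat \<times> nat \<Rightarrow> real" where
  "filled_fraction D \<theta> b es e =
     fill (seg_cost D \<theta> b)
       (capacity D \<theta> b - (\<Sum>i\<in>items D. fst (hull_list D \<theta> b i ! 0))) es e / seg_cost D \<theta> b e"

text \<open>The hull-greedy LP solution as weights on the hull vertices: filling a fraction \<open>f\<close> of
  segment \<open>(i, k)\<close> moves weight \<open>f\<close> from vertex \<open>k\<close> to vertex \<open>k + 1\<close>, starting from weight \<open>1\<close>
  on vertex \<open>0\<close>.\<close>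

definition greedy_weight ::
    "pricing_data \<Rightarrow> real \<Rightarrow> (nat \<Rightarrow> nat) \<Rightarrow> (nat \<times> nat) list \<Rightarrow> nat \<Rightarrow> nat \<Rightarrow> real" where
  "greedy_weight D \<theta> b es i k =
     (if k = 0 then 1 else filled_fraction D \<theta> b es (i, k - 1)) -
     (if k + 1 < length (hull_list D \<theta> b i) then filled_fraction D \<theta> b es (i, k) else 0)"

text \<open>The cheapest vertex carrying positive weight: the vertex where the item sits if it is not
  fractional, and the cheaper of its two adjacent vertices if it is.\<close>

definition round_down_vertex ::
    "pricing_data \<Rightarrow> real \<Rightarrow> (nat \<Rightarrow> nat) \<Rightarrow> (nat \<times> nat) list \<Rightarrow> nat \<Rightarrow> nat" where
  "round_down_vertex D \<theta> b es i =
     (LEAST k. k < length (hull_list D \<theta> b i) \<and> greedy_weight D \<theta> b es i k > 0)"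

text \<open>Several options may correspond to the same vertex; any of them may be used.\<close>

definition round_down_solution ::
    "pricing_data \<Rightarrow> real \<Rightarrow> (nat \<Rightarrow> nat) \<Rightarrow> (nat \<times> nat) list \<Rightarrow> (nat \<Rightarrow> real) \<Rightarrow> bool" where
  "round_down_solution D \<theta> b es x \<longleftrightarrow>
     (\<forall>i\<in>items D. \<exists>j\<in>options D i.
        x i = price D i j \<and>
        hull_list D \<theta> b i ! round_down_vertex D \<theta> b es i = (opt_cost D \<theta> b i j, opt_value D i j))"

end

theory Submission
  imports Defs
begin

text \<open>
  The bound is weak Lagrangian duality with the slope of the critical segment as multiplier. For
  every \<open>\<mu> \<ge> 0\<close>, the LP optimum is at most \<open>\<mu> C + \<Sum>\<^sub>i max\<^sub>j (v\<^sub>i\<^sub>j - \<mu> c\<^sub>i\<^sub>j)\<close>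
  (lemma \<open>knapsack_weak_duality\<close>). Let \<open>\<mu>\<close> be the slope of the first segment that the greedy fill
  does not complete, or \<open>0\<close> if it completes them all. Completed segments then have slope at least
  \<open>\<mu>\<close> and all the others at most \<open>\<mu>\<close> (lemma \<open>fill_threshold\<close>), so the round-down
  vertex \<open>r(i)\<close> of each item, which separates the two kinds on the hull of \<open>i\<close>, maximises
  \<open>v - \<mu> c\<close> over all points of the item (lemma \<open>hull_maximiser\<close>). Hence the gap between the LP optimum
  and the value of the round-down solution is at most \<open>\<mu> (C - \<Sum>\<^sub>i c\<^sub>i\<^sub>,\<^sub>r\<^sub>(\<^sub>i\<^sub>))\<close>. The capacity
  in the brackets is what was left for the critical segment, so it is less than the length of that
  segment, and the product is at most its value jump; if there is no critical segment, the product
  is \<open>0\<close>. The bound for the integer problem follows because its solutions are integral LP solutions.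

  The greedy fill is meaningful only because the hull is strictly concave: the completed segments of
  an item form an initial piece of its hull, and this piece ends exactly at the round-down vertex.
\<close>

section \<open>Upper hulls as concave chains\<close>

text \<open>Breaking ties towards small cost makes the maximiser \<open>p\<close> of \<open>v - \<mu> c\<close> an extreme point
  even if a whole edge of the hull is optimal, and makes it undominated even if \<open>\<mu> = 0\<close>.\<close>

lemma lex_maximiser_in_upper_hull_vertices:
  fixes P :: "(real \<times> real) set"
  assumes "0 \<le> \<mu>" and pP: "p \<in> P"
    and lex: "\<And>q. q \<in> P \<Longrightarrow> snd q - \<mu> * fst q < snd p - \<mu> * fst p \<or>
               snd q - \<mu> * fst q = snd p - \<mu> * fst p \<and> fst p \<le> fst q"
  shows "p \<in> upper_hull_vertices (undominated P)"
proof -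
  define \<phi> :: "real \<times> real \<Rightarrow> real" where "\<phi> q = snd q - \<mu> * fst q" for q
  define L where "L = {q. \<phi> q < \<phi> p \<or> \<phi> q = \<phi> p \<and> fst p \<le> fst q}"
  have \<phi>_comb: "\<phi> (u *\<^sub>R x + v *\<^sub>R y) = u * \<phi> x + v * \<phi> y" for u v x y
    by (simp add: \<phi>_def algebra_simps)
  have "p \<in> undominated P"
  proof -
    have "q = p" if "q \<in> P" "fst q \<le> fst p" "snd p \<le> snd q" for q
    proof -
      have "\<mu> * fst q \<le> \<mu> * fst p" using that(2) \<open>0 \<le> \<mu>\<close> by (rule mult_left_mono)
      with lex[OF that(1)] that show "q = p" by (auto simp: prod_eq_iff)
    qed
    with pP show ?thesis by (auto simp: undominated_def)
  qed
  have "convex L"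
  proof (rule convexI)
    fix x y :: "real \<times> real" and u v :: real
    assume xy: "x \<in> L" "y \<in> L" and uv: "0 \<le> u" "0 \<le> v" "u + v = 1"
    have p_comb: "u * t + v * t = t" for t :: real
      using uv(3) by (simp flip: distrib_right)
    have le: "u * \<phi> x \<le> u * \<phi> p" "v * \<phi> y \<le> v * \<phi> p"
      using xy uv by (auto simp: L_def intro: mult_left_mono)
    show "u *\<^sub>R x + v *\<^sub>R y \<in> L"
    proof (cases "\<phi> (u *\<^sub>R x + v *\<^sub>R y) = \<phi> p")
      case False
      then show ?thesis using le p_comb[of "\<phi> p"] by (simp add: L_def \<phi>_comb)
    next
      case True
      then have "u * \<phi> x = u * \<phi> p" "v * \<phi> y = v * \<phi> p"
        using le p_comb[of "\<phi> p"] unfolding \<phi>_comb by linarith+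
      then have "u = 0 \<or> fst p \<le> fst x" "v = 0 \<or> fst p \<le> fst y"
        using xy by (auto simp: L_def)
      then have "u * fst p \<le> u * fst x" "v * fst p \<le> v * fst y"
        using uv by (auto intro: mult_left_mono)
      with True p_comb[of "fst p"] show ?thesis by (simp add: L_def)
    qed
  qed
  moreover have "undominated P \<subseteq> L" using lex by (auto simp: undominated_def L_def \<phi>_def)
  ultimately have hull: "convex hull (undominated P) \<subseteq> L" by (rule hull_minimal[rotated])
  have "p \<notin> open_segment x y" if "x \<in> L" "y \<in> L" for x y
  proof
    assume "p \<in> open_segment x y"
    then obtain u where u: "0 < u" "u < 1" "p = (1 - u) *\<^sub>R x + u *\<^sub>R y" and "x \<noteq> y"
      by (auto simp: in_segment)
    have \<phi>p: "\<phi> p = (1 - u) * \<phi> x + u * \<phi> y" using u(3) \<phi>_comb by simp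
    have fp: "fst p = (1 - u) * fst x + u * fst y" using u(3) by simp
    have *: "s = t \<and> s' = t" if "s \<le> t" "s' \<le> t" "t = (1 - u) * s + u * s'" for s s' t :: real
    proof -
      have "(1 - u) * (t - s) + u * (t - s') = 0" using that(3) by (simp add: algebra_simps)
      moreover have "0 \<le> (1 - u) * (t - s)" "0 \<le> u * (t - s')" using that u by auto
      ultimately have "(1 - u) * (t - s) = 0" "u * (t - s') = 0" by linarith+
      then show ?thesis using u by simp
    qed
    have "\<phi> x \<le> \<phi> p" "\<phi> y \<le> \<phi> p" using that by (auto simp: L_def)
    then have \<phi>: "\<phi> x = \<phi> p" "\<phi> y = \<phi> p" using * \<phi>p by blast+
    then have "fst p \<le> fst x" "fst p \<le> fst y" using that by (auto simp: L_def)
    moreover have "- fst p = (1 - u) * (- fst x) + u * (- fst y)" using fp by simp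
    ultimately have "- fst x = - fst p \<and> - fst y = - fst p" by (intro *) simp_all
    with \<phi> have "x = y" by (simp add: \<phi>_def prod_eq_iff)
    with \<open>x \<noteq> y\<close> show False ..
  qed
  moreover have "p \<in> convex hull (undominated P)"
    using \<open>p \<in> undominated P\<close> by (rule hull_inc)
  ultimately have "p extreme_point_of convex hull (undominated P)"
    using hull unfolding extreme_point_of_def by blast
  moreover have "y \<le> snd p" if "(fst p, y) \<in> convex hull (undominated P)" for y
    using that hull by (auto simp: L_def \<phi>_def)
  ultimately show ?thesis by (simp add: upper_hull_vertices_def)
qed

lemma supporting_hull_vertex:
  fixes P :: "(real \<times> real) set"
  assumes "finite P" "P \<noteq> {}" "0 \<le> \<mu>"
  obtains p where "p \<in> upper_hull_vertices (undominated P)"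
    and "\<And>q. q \<in> P \<Longrightarrow> snd q - \<mu> * fst q \<le> snd p - \<mu> * fst p"
proof -
  define \<phi> :: "real \<times> real \<Rightarrow> real" where "\<phi> q = snd q - \<mu> * fst q" for q
  define A where "A = {q \<in> P. \<forall>q'\<in>P. \<phi> q' \<le> \<phi> q}"
  have "Max (\<phi> ` P) \<in> \<phi> ` P" using assms by (intro Max_in) auto
  then obtain q where q: "q \<in> P" "\<phi> q = Max (\<phi> ` P)" by auto
  have "\<phi> q' \<le> \<phi> q" if "q' \<in> P" for q' unfolding q(2) using that assms by simp
  then have "q \<in> A" using q(1) by (simp add: A_def)
  then have "A \<noteq> {}" by blast
  moreover have "finite A" using assms by (simp add: A_def)
  ultimately have "Min (fst ` A) \<in> fst ` A" by (intro Min_in) auto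
  then obtain p where p: "p \<in> A" "fst p = Min (fst ` A)" by auto
  have min: "fst p \<le> fst q" if "q \<in> A" for q using p assms that by (simp add: A_def)
  have max: "\<phi> q \<le> \<phi> p" if "q \<in> P" for q using p that by (simp add: A_def)
  have "p \<in> upper_hull_vertices (undominated P)"
  proof (rule lex_maximiser_in_upper_hull_vertices[OF assms(3)])
    show "p \<in> P" using p by (simp add: A_def)
    fix q assume q: "q \<in> P"
    have "fst p \<le> fst q" if "\<phi> q = \<phi> p"
      using q that max min by (simp add: A_def)
    then show "snd q - \<mu> * fst q < snd p - \<mu> * fst p \<or>
               snd q - \<mu> * fst q = snd p - \<mu> * fst p \<and> fst p \<le> fst q"
      using max[OF q] unfolding \<phi>_def by linarith
  qed
  then show thesis using max by (intro that[of p]) (auto simp: \<phi>_def)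
qed

lemma upper_hull_vertices_value_less:
  assumes "p \<in> upper_hull_vertices (undominated P)" "q \<in> upper_hull_vertices (undominated P)"
    and "fst p < fst q"
  shows "snd p < snd q"
proof -
  have "p \<in> undominated P" "q \<in> undominated P"
    using assms upper_hull_vertices_subset by blast+
  with assms(3) show ?thesis unfolding undominated_def by force
qed

text \<open>The chord from \<open>p\<close> to \<open>r\<close> lies in the hull. It cannot pass above \<open>q\<close>, which is on the upper
  boundary, nor through \<open>q\<close>, which is extreme.\<close>

lemma upper_hull_vertices_strictly_concave:
  assumes V: "p \<in> upper_hull_vertices E" "q \<in> upper_hull_vertices E" "r \<in> upper_hull_vertices E"
    and lt: "fst p < fst q" "fst q < fst r"
  shows "(snd r - snd q) / (fst r - fst q) < (snd q - snd p) / (fst q - fst p)"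
proof -
  define u where "u = (fst q - fst p) / (fst r - fst p)"
  define m where "m = (1 - u) *\<^sub>R p + u *\<^sub>R r"
  have u: "0 < u" "u < 1" using lt by (auto simp: u_def)
  have hull: "p \<in> convex hull E" "r \<in> convex hull E"
    using V by (auto simp: upper_hull_vertices_def extreme_point_of_def)
  have m_seg: "m \<in> open_segment p r" using u lt by (auto simp: m_def in_segment)
  have u_eq: "u * (fst r - fst p) = fst q - fst p" using lt by (simp add: u_def)
  have fst_m: "fst m = fst q" using u_eq by (simp add: m_def algebra_simps)
  have "open_segment p r \<subseteq> convex hull E"
    using hull by (meson convex_convex_hull convex_contains_open_segment)
  then have "m \<in> convex hull E" using m_seg by blast
  then have "snd m \<le> snd q"
    using V(2) fst_m
    unfolding upper_hull_vertices_def by (metis (mono_tags, lifting) mem_Collect_eq prod.collapse)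
  moreover have "m \<noteq> q"
    using V(2) hull m_seg by (auto simp: upper_hull_vertices_def extreme_point_of_def)
  ultimately have "snd m < snd q" using fst_m by (auto simp: prod_eq_iff)
  then have "snd p + u * (snd r - snd p) < snd q" by (simp add: m_def algebra_simps)
  then have "(snd p + u * (snd r - snd p)) * (fst r - fst p) < snd q * (fst r - fst p)"
    using lt by (intro mult_strict_right_mono) auto
  moreover have "(snd p + u * (snd r - snd p)) * (fst r - fst p) =
      snd p * (fst r - fst p) + (u * (fst r - fst p)) * (snd r - snd p)"
    by (simp add: algebra_simps)
  ultimately have "snd p * (fst r - fst p) + (fst q - fst p) * (snd r - snd p)
      < snd q * (fst r - fst p)"
    unfolding u_eq by simp
  then have "(snd r - snd q) * (fst q - fst p) < (snd q - snd p) * (fst r - fst q)"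
    by (simp add: algebra_simps)
  then show ?thesis using lt by (simp add: divide_less_eq less_divide_eq mult.commute)
qed

context
  fixes P :: "(real \<times> real) set" and ps :: "(real \<times> real) list"
  assumes fin: "finite P" and ne: "P \<noteq> {}"
    and vertices: "set ps = upper_hull_vertices (undominated P)"
    and sorted: "sorted_wrt (\<lambda>p q. fst p < fst q) ps"
begin

lemma hull_nonempty: "ps \<noteq> []"
proof -
  obtain p where "p \<in> set ps"
    using supporting_hull_vertex[OF fin ne order_refl] unfolding vertices by blast
  then show ?thesis by auto
qed

lemma hull_cost_less: "j < k \<Longrightarrow> k < length ps \<Longrightarrow> fst (ps ! j) < fst (ps ! k)"
  using sorted by (simp add: sorted_wrt_iff_nth_less)

lemma hull_value_less: "j < k \<Longrightarrow> k < length ps \<Longrightarrow> snd (ps ! j) < snd (ps ! k)"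
  by (rule upper_hull_vertices_value_less[of _ P]) (simp_all add: hull_cost_less flip: vertices)

lemma hull_slope_less:
  assumes "j < k" "k + 1 < length ps"
  shows "(snd (ps ! (k + 1)) - snd (ps ! k)) / (fst (ps ! (k + 1)) - fst (ps ! k))
       < (snd (ps ! (j + 1)) - snd (ps ! j)) / (fst (ps ! (j + 1)) - fst (ps ! j))"
proof -
  have chord: "(snd (ps ! c) - snd (ps ! b)) / (fst (ps ! c) - fst (ps ! b))
      < (snd (ps ! b) - snd (ps ! a)) / (fst (ps ! b) - fst (ps ! a))"
    if "a < b" "b < c" "c < length ps" for a b c
    using that hull_cost_less vertices
    by (intro upper_hull_vertices_strictly_concave[where E = "undominated P"])
      (auto simp flip: vertices)
  show ?thesis
  proof (cases "j + 1 = k")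
    case True
    then show ?thesis using chord[of j k "k + 1"] assms by simp
  next
    case False
    then show ?thesis
      using chord[of "j + 1" k "k + 1"] chord[of j "j + 1" k] assms by linarith
  qed
qed

text \<open>If \<open>q\<close> were cheaper than \<open>ps ! 0\<close>, then it would be cheaper than every vertex, and for
  large \<open>\<mu>\<close> no vertex could maximise \<open>v - \<mu> c\<close>: its value would have to exceed all values in \<open>P\<close>.\<close>

lemma hull_first_cheapest:
  assumes "q \<in> P"
  shows "fst (ps ! 0) \<le> fst q"
proof (rule ccontr)
  assume "\<not> fst (ps ! 0) \<le> fst q"
  define \<epsilon> where "\<epsilon> = fst (ps ! 0) - fst q"
  have "0 < \<epsilon>" using \<open>\<not> fst (ps ! 0) \<le> fst q\<close> by (simp add: \<epsilon>_def)
  define M where "M = Max (snd ` P)"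
  have M: "snd p \<le> M" if "p \<in> P" for p using that fin by (simp add: M_def)
  define \<mu> where "\<mu> = (M - snd q + 1) / \<epsilon>"
  have "0 \<le> \<mu>" using M[OF assms] \<open>0 < \<epsilon>\<close> by (simp add: \<mu>_def)
  then obtain p where p: "p \<in> set ps" "snd q - \<mu> * fst q \<le> snd p - \<mu> * fst p"
    using supporting_hull_vertex[OF fin ne] assms vertices by metis
  then obtain s where s: "s < length ps" "p = ps ! s" by (auto simp: in_set_conv_nth)
  then have "fst (ps ! 0) \<le> fst p" using hull_cost_less[of 0 s] by (cases s) auto
  then have "\<mu> * \<epsilon> \<le> \<mu> * (fst p - fst q)"
    using \<open>0 \<le> \<mu>\<close> by (intro mult_left_mono) (auto simp: \<epsilon>_def)
  moreover have "\<mu> * \<epsilon> = M - snd q + 1" using \<open>0 < \<epsilon>\<close> by (simp add: \<mu>_def)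
  moreover have "p \<in> P"
    using p vertices upper_hull_vertices_subset[of "undominated P"] by (auto simp: undominated_def)
  ultimately show False using p(2) M[of p] by (simp add: algebra_simps)
qed

text \<open>Along the chain, \<open>v - \<mu> c\<close> increases up to \<open>r\<close> and decreases after it; and some vertex
  is optimal for it among all points.\<close>

lemma hull_maximiser:
  assumes "0 \<le> \<mu>" and r: "r < length ps"
    and steep: "\<And>k. k < r \<Longrightarrow>
      \<mu> \<le> (snd (ps ! (k + 1)) - snd (ps ! k)) / (fst (ps ! (k + 1)) - fst (ps ! k))"
    and flat: "\<And>k. r \<le> k \<Longrightarrow> k + 1 < length ps \<Longrightarrow>
      (snd (ps ! (k + 1)) - snd (ps ! k)) / (fst (ps ! (k + 1)) - fst (ps ! k)) \<le> \<mu>"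
    and "q \<in> P"
  shows "snd q - \<mu> * fst q \<le> snd (ps ! r) - \<mu> * fst (ps ! r)"
proof -
  define \<phi> where "\<phi> k = snd (ps ! k) - \<mu> * fst (ps ! k)" for k
  have cost: "0 < fst (ps ! (k + 1)) - fst (ps ! k)" if "k + 1 < length ps" for k
    using hull_cost_less[of k "k + 1"] that by simp
  have up: "\<phi> k \<le> \<phi> (Suc k)" if "k < r" for k
    using steep[OF that] cost[of k] r that by (simp add: \<phi>_def le_divide_eq algebra_simps)
  have down: "\<phi> (Suc k) \<le> \<phi> k" if "r \<le> k" "k + 1 < length ps" for k
    using flat[OF that] cost[of k] that by (simp add: \<phi>_def divide_le_eq algebra_simps)
  obtain p where p: "p \<in> set ps" "snd q - \<mu> * fst q \<le> snd p - \<mu> * fst p"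
    using supporting_hull_vertex[OF fin ne \<open>0 \<le> \<mu>\<close>] assms(5) vertices by metis
  then obtain s where s: "s < length ps" "p = ps ! s" by (auto simp: in_set_conv_nth)
  have "\<phi> s \<le> \<phi> r"
  proof (cases "s \<le> r")
    case True
    then show ?thesis
    proof (induction s rule: inc_induct)
      case (step n)
      then show ?case using up[of n] by linarith
    qed simp
  next
    case False
    then have "r \<le> s" by simp
    then show ?thesis using s(1)
    proof (induction s rule: dec_induct)
      case (step n)
      then show ?case using down[of n] by simp
    qed simp
  qed
  with p s show ?thesis by (simp add: \<phi>_def)
qed

end

section \<open>Greedy filling\<close>

lemma fill_le: "0 \<le> len e \<Longrightarrow> fill len R es e \<le> len e"
  by (induction es arbitrary: R) auto

lemma fill_no_capacity: "(\<And>e. e \<in> set es \<Longrightarrow> 0 < len e) \<Longrightarrow> fill len 0 es e = 0"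
  by (induction es) auto

lemma fill_prefix:
  assumes "distinct es" "\<And>e. e \<in> set es \<Longrightarrow> 0 < len e" "0 \<le> R"
  shows "\<exists>pre suf. es = pre @ suf \<and> {e \<in> set es. fill len R es e = len e} = set pre \<and>
           (suf \<noteq> [] \<longrightarrow> R - sum len (set pre) < len (hd suf))"
  using assms
proof (induction es arbitrary: R)
  case Nil
  then show ?case by simp
next
  case (Cons e es)
  show ?case
  proof (cases "len e \<le> R")
    case True
    have "\<exists>pre suf. es = pre @ suf \<and>
        {x \<in> set es. fill len (R - len e) es x = len x} = set pre \<and>
        (suf \<noteq> [] \<longrightarrow> R - len e - sum len (set pre) < len (hd suf))"
      by (rule Cons.IH) (use Cons.prems True in auto)
    then obtain pre suf where *: "es = pre @ suf"
      "{x \<in> set es. fill len (R - len e) es x = len x} = set pre"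
      "suf \<noteq> [] \<longrightarrow> R - len e - sum len (set pre) < len (hd suf)"
      by blast
    have "e \<notin> set es" using Cons.prems by simp
    then have "{x \<in> set (e # es). fill len R (e # es) x = len x} = set (e # pre)"
      unfolding list.set *(2)[symmetric] using True by (auto simp: min_def)
    moreover have "sum len (set (e # pre)) = len e + sum len (set pre)"
      using \<open>e \<notin> set es\<close> *(1) by simp
    ultimately show ?thesis using * by (intro exI[of _ "e # pre"] exI[of _ suf]) auto
  next
    case False
    have "fill len R (e # es) x \<noteq> len x" if "x \<in> set (e # es)" for x
    proof -
      have "fill len 0 es x = 0" using Cons.prems(2) by (intro fill_no_capacity) simp
      moreover have "0 < len x" using Cons.prems(2) that .
      ultimately show ?thesis using False by (simp add: min_def)
    qed
    then have "{x \<in> set (e # es). fill len R (e # es) x = len x} = set []"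
      unfolding list.set(1) by blast
    moreover have "R - sum len (set []) < len (hd (e # es))" using False by simp
    ultimately show ?thesis by (metis append_Nil)
  qed
qed

text \<open>The threshold \<open>\<mu>\<close> is the slope of the first incomplete segment; \<open>M\<close> bounds the value
  of every single segment. The last claim holds because the incomplete segment does not fit in the
  capacity left by the completed ones.\<close>

lemma fill_threshold:
  fixes len slope :: "'e \<Rightarrow> real"
  assumes "distinct es" and len: "\<And>e. e \<in> set es \<Longrightarrow> 0 < len e" and "0 \<le> R"
    and sorted: "sorted_wrt (\<lambda>e e'. slope e \<ge> slope e') es"
    and slope: "\<And>e. e \<in> set es \<Longrightarrow> 0 \<le> slope e"
    and jump: "\<And>e. e \<in> set es \<Longrightarrow> slope e * len e \<le> M" and "0 \<le> M"
    and F: "F = {e \<in> set es. fill len R es e = len e}"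
  obtains \<mu> where "0 \<le> \<mu>" "\<And>e. e \<in> F \<Longrightarrow> \<mu> \<le> slope e" "\<And>e. e \<in> set es - F \<Longrightarrow> slope e \<le> \<mu>"
    "\<mu> * (R - sum len F) \<le> M"
proof -
  have "\<exists>pre suf. es = pre @ suf \<and> F = set pre \<and>
      (suf \<noteq> [] \<longrightarrow> R - sum len (set pre) < len (hd suf))"
    unfolding F using fill_prefix[OF \<open>distinct es\<close> _ \<open>0 \<le> R\<close>] len by simp
  then obtain pre suf where *: "es = pre @ suf" "F = set pre"
    "suf \<noteq> [] \<longrightarrow> R - sum len (set pre) < len (hd suf)"
    by blast
  show thesis
  proof (cases suf)
    case Nil
    then show thesis using * slope \<open>0 \<le> M\<close> by (intro that[of 0]) auto
  next
    case (Cons c cs)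
    have "slope c * (R - sum len F) \<le> slope c * len c"
      using * Cons slope by (intro mult_left_mono) auto
    also have "\<dots> \<le> M" using jump * Cons by simp
    finally show thesis
      using * Cons slope sorted by (intro that[of "slope c"]) (auto simp: sorted_wrt_append)
  qed
qed

text \<open>With \<open>f k\<close> the filled fraction of segment \<open>k\<close>, the vertices before the first incomplete
  segment carry weight \<open>1 - 1 = 0\<close>, and the vertex at which this segment starts carries
  \<open>1 - f r > 0\<close>.\<close>

lemma Least_positive_weight:
  fixes f :: "nat \<Rightarrow> real"
  assumes "0 < L" and f_le: "\<And>k. k + 1 < L \<Longrightarrow> f k \<le> 1"
    and r: "r = (LEAST k. k < L \<and>
      0 < (if k = 0 then 1 else f (k - 1)) - (if k + 1 < L then f k else 0))"
  shows "r < L" "\<And>k. k < r \<Longrightarrow> f k = 1" "r + 1 < L \<Longrightarrow> f r < 1"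
proof -
  define s where "s = (LEAST k. k + 1 < L \<longrightarrow> f k < 1)"
  have s: "s + 1 < L \<longrightarrow> f s < 1"
    unfolding s_def by (rule LeastI[of _ L]) simp
  have s_le: "s \<le> L - 1" unfolding s_def using \<open>0 < L\<close> by (intro Least_le) simp
  then have "s < L" using \<open>0 < L\<close> by simp
  have full: "f k = 1" if "k < s" for k
  proof -
    have "k + 1 < L" using that s_le by simp
    moreover have "\<not> (k + 1 < L \<longrightarrow> f k < 1)" using that unfolding s_def by (rule not_less_Least)
    ultimately show ?thesis using f_le[of k] by simp
  qed
  have "r = s"
    unfolding r
  proof (rule Least_equality)
    show "s < L \<and> 0 < (if s = 0 then 1 else f (s - 1)) - (if s + 1 < L then f s else 0)"
      using s \<open>s < L\<close> full[of "s - 1"] by auto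
  next
    fix k assume k: "k < L \<and> 0 < (if k = 0 then 1 else f (k - 1)) - (if k + 1 < L then f k else 0)"
    show "s \<le> k"
    proof (rule ccontr)
      assume "\<not> s \<le> k"
      then show False using k full[of k] full[of "k - 1"] s_le by (auto split: if_splits)
    qed
  qed
  with s \<open>s < L\<close> full show "r < L" "\<And>k. k < r \<Longrightarrow> f k = 1" "r + 1 < L \<Longrightarrow> f r < 1" by auto
qed

section \<open>Weak duality\<close>

lemma knapsack_weak_duality:
  fixes v c z :: "'i \<Rightarrow> 'j \<Rightarrow> real"
  assumes z: "\<And>i j. i \<in> I \<Longrightarrow> j \<in> J i \<Longrightarrow> 0 \<le> z i j" "\<And>i. i \<in> I \<Longrightarrow> (\<Sum>j\<in>J i. z i j) = 1"
    and cap: "(\<Sum>i\<in>I. \<Sum>j\<in>J i. c i j * z i j) \<le> C"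
    and "0 \<le> \<mu>" and opt: "\<And>i j. i \<in> I \<Longrightarrow> j \<in> J i \<Longrightarrow> v i j - \<mu> * c i j \<le> m i"
  shows "(\<Sum>i\<in>I. \<Sum>j\<in>J i. v i j * z i j) \<le> (\<Sum>i\<in>I. m i) + \<mu> * C"
proof -
  have "(\<Sum>j\<in>J i. v i j * z i j) \<le> m i + \<mu> * (\<Sum>j\<in>J i. c i j * z i j)" if i: "i \<in> I" for i
  proof -
    have "(\<Sum>j\<in>J i. (v i j - \<mu> * c i j) * z i j) \<le> (\<Sum>j\<in>J i. m i * z i j)"
      using opt z(1) i by (intro sum_mono mult_right_mono) auto
    also have "\<dots> = m i" using z(2)[OF i] by (simp flip: sum_distrib_left)
    finally show ?thesis
      by (simp add: left_diff_distrib sum_subtractf sum_distrib_left mult.assoc)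
  qed
  then have "(\<Sum>i\<in>I. \<Sum>j\<in>J i. v i j * z i j)
      \<le> (\<Sum>i\<in>I. m i + \<mu> * (\<Sum>j\<in>J i. c i j * z i j))"
    by (rule sum_mono)
  also have "\<dots> = (\<Sum>i\<in>I. m i) + \<mu> * (\<Sum>i\<in>I. \<Sum>j\<in>J i. c i j * z i j)"
    by (simp add: sum.distrib sum_distrib_left)
  also have "\<dots> \<le> (\<Sum>i\<in>I. m i) + \<mu> * C"
    using cap \<open>0 \<le> \<mu>\<close> by (intro add_left_mono mult_left_mono)
  finally show ?thesis .
qed

section \<open>The fixed-\<open>\<theta>\<close> problem\<close>

lemma finite_option_set: "finite (options D i)"
  by (simp add: options_def)

lemma ip_values_subset_lp_values:
  "{\<Sum>i\<in>items D. opt_value D i (j i) | j. ip_feasible D \<theta> b j}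
   \<subseteq> {\<Sum>i\<in>items D. \<Sum>j\<in>options D i. opt_value D i j * z i j | z. lp_feasible D \<theta> b z}"
proof clarify
  fix j assume j: "ip_feasible D \<theta> b j"
  define z :: "nat \<Rightarrow> nat \<Rightarrow> real" where "z i k = (if k = j i then 1 else 0)" for i k
  have sum_z: "(\<Sum>k\<in>options D i. w k * z i k) = w (j i)" if "i \<in> items D" for i and w :: "nat \<Rightarrow> real"
  proof -
    have "(\<Sum>k\<in>options D i. w k * z i k) = (\<Sum>k\<in>options D i. if j i = k then w k else 0)"
      by (intro sum.cong) (auto simp: z_def)
    then show ?thesis using j that finite_option_set by (simp add: ip_feasible_def)
  qed
  have "lp_feasible D \<theta> b z"
    unfolding lp_feasible_def
  proof (intro conjI ballI)
    show "0 \<le> z i k" for i k by (simp add: z_def)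
    show "(\<Sum>k\<in>options D i. z i k) = 1" if "i \<in> items D" for i
      using sum_z[OF that, of "\<lambda>_. 1"] by simp
    show "(\<Sum>i\<in>items D. \<Sum>k\<in>options D i. opt_cost D \<theta> b i k * z i k) \<le> capacity D \<theta> b"
      using j sum_z by (simp add: ip_feasible_def)
  qed
  moreover have "(\<Sum>i\<in>items D. opt_value D i (j i))
      = (\<Sum>i\<in>items D. \<Sum>k\<in>options D i. opt_value D i k * z i k)"
    using sum_z by simp
  ultimately show "\<exists>z. (\<Sum>i\<in>items D. opt_value D i (j i))
      = (\<Sum>i\<in>items D. \<Sum>k\<in>options D i. opt_value D i k * z i k) \<and> lp_feasible D \<theta> b z"
    by blast
qed

lemma base_choice_admissible: "base_choice D \<theta> b \<Longrightarrow> i \<in> items D \<Longrightarrow> b i \<in> options D i"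
  by (simp add: base_choice_def is_arg_max_def)

lemma base_choice_ip_feasible:
  "base_choice D \<theta> b \<Longrightarrow> 0 \<le> capacity D \<theta> b \<Longrightarrow> ip_feasible D \<theta> b b"
  using base_choice_admissible by (simp add: ip_feasible_def opt_cost_def)

lemma seg_value_le_max_jump:
  assumes "(i, k) \<in> segments D \<theta> b"
  shows "seg_value D \<theta> b (i, k) \<le> max_jump D \<theta> b"
proof -
  let ?K = "{k. k + 1 < length (hull_list D \<theta> b i)}"
  have "finite ?K" by (rule finite_subset[of _ "{..<length (hull_list D \<theta> b i)}"]) auto
  then have "seg_value D \<theta> b (i, k) \<le> (MAX k\<in>?K. seg_value D \<theta> b (i, k))"
    using assms by (intro Max_ge) (auto simp: segments_def)
  also have "\<dots> = (if length (hull_list D \<theta> b i) = 1 then 0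
        else MAX k\<in>?K. seg_value D \<theta> b (i, k))"
    using assms by (auto simp: segments_def)
  also have "\<dots> \<le> max_jump D \<theta> b"
    unfolding max_jump_def using assms by (intro Max_ge) (auto simp: segments_def)
  finally show ?thesis .
qed

theorem proposition8:
  fixes D :: pricing_data and \<theta> :: real and b :: "nat \<Rightarrow> nat"
    and es :: "(nat \<times> nat) list" and x :: "nat \<Rightarrow> real"
  assumes "valid_data D"
    and "\<theta> \<in> breakpoints D"
    and "base_choice D \<theta> b"
    and "capacity D \<theta> b \<ge> 0"
    and "greedy_order D \<theta> b es"
    and "round_down_solution D \<theta> b es x"
  shows "opt_lp D \<theta> b - nominal_revenue D x \<le> max_jump D \<theta> b \<and>
         opt_ip D \<theta> b - nominal_revenue D x \<le> max_jump D \<theta> b"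
proof -
  define I where "I = items D"
  define H where "H = hull_list D \<theta> b"
  define P where "P = points D \<theta> b"
  define len where "len = seg_cost D \<theta> b"
  define slope where "slope = seg_slope D \<theta> b"
  define M where "M = max_jump D \<theta> b"
  define C where "C = capacity D \<theta> b"
  define R where "R = C - (\<Sum>i\<in>I. fst (H i ! 0))"
  define r where "r = round_down_vertex D \<theta> b es"
  define F where "F = {e \<in> set es. fill len R es e = len e}"
  note unfold = I_def H_def P_def len_def slope_def M_def C_def

  have fin: "finite (P i)" for i by (simp add: unfold points_def finite_option_set)
  have ne: "P i \<noteq> {}" if "i \<in> I" for i
    using base_choice_admissible[OF assms(3)] that by (auto simp: unfold points_def)
  have set_H: "set (H i) = upper_hull_vertices (undominated (P i))"
    and sorted_H: "sorted_wrt (\<lambda>p q. fst p < fst q) (H i)" for i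
    using hull_list_correct by (auto simp: unfold)
  note hull = fin ne set_H sorted_H
  have es: "distinct es" "set es = segments D \<theta> b" "sorted_wrt (\<lambda>e e'. slope e \<ge> slope e') es"
    using assms(5) by (auto simp: greedy_order_def unfold)
  have seg: "(i, k) \<in> set es \<longleftrightarrow> i \<in> I \<and> k + 1 < length (H i)" for i k
    by (simp add: es segments_def unfold)
  have len_eq: "len (i, k) = fst (H i ! (k + 1)) - fst (H i ! k)" for i k
    by (simp add: unfold seg_cost_def)
  have slope_eq: "slope (i, k) =
      (snd (H i ! (k + 1)) - snd (H i ! k)) / (fst (H i ! (k + 1)) - fst (H i ! k))" for i k
    by (simp add: unfold seg_slope_def seg_cost_def seg_value_def)

  have len_pos: "0 < len e" if "e \<in> set es" for e
  proof -
    obtain i k where "e = (i, k)" by (cases e)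
    then show ?thesis using that hull_cost_less[OF hull, of i k "k + 1"] by (simp add: seg len_eq)
  qed
  have slope_nonneg: "0 \<le> slope e" if "e \<in> set es" for e
  proof -
    obtain i k where "e = (i, k)" by (cases e)
    then show ?thesis
      using that hull_cost_less[OF hull, of i k "k + 1"] hull_value_less[OF hull, of i k "k + 1"]
      by (simp add: seg slope_eq)
  qed
  have slope_strict: "slope (i, k) < slope (i, j)" if "j < k" "(i, k) \<in> set es" for i j k
    using that hull_slope_less[OF hull] by (auto simp: seg slope_eq)
  have jump: "slope e * len e \<le> M" if "e \<in> set es" for e
    using that len_pos[OF that] seg_value_le_max_jump[of "fst e" "snd e" D \<theta> b] es(2)
    by (simp add: unfold seg_slope_def)

  have "0 \<le> M"
  proof -
    have one: "1 \<in> I" using assms(1) by (simp add: valid_data_def unfold)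
    have "H 1 \<noteq> []" by (rule hull_nonempty[OF hull]) (use one in auto)
    show ?thesis
    proof (cases "length (H 1) = 1")
      case True
      then have "0 = (if length (H 1) = 1 then 0
        else MAX k\<in>{k. k + 1 < length (H 1)}. seg_value D \<theta> b (1, k))" by simp
      also have "\<dots> \<le> M"
        unfolding M_def max_jump_def H_def using one by (intro Max_ge) (auto simp: I_def)
      finally show ?thesis .
    next
      case False
      then have "(1, 0) \<in> set es" using one \<open>H 1 \<noteq> []\<close> by (cases "H 1") (auto simp: seg)
      then show ?thesis using jump len_pos slope_nonneg
        by (meson less_imp_le mult_nonneg_nonneg order_trans)
    qed
  qed

  \<comment> \<open>The base choice has cost \<open>0\<close>, so every item starts at cost at most \<open>0\<close>.\<close>
  have "0 \<le> R"
  proof -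
    have "fst (H i ! 0) \<le> 0" if "i \<in> I" for i
    proof -
      have "(0, opt_value D i (b i)) \<in> P i"
        using base_choice_admissible[OF assms(3)] that
        by (force simp: unfold points_def opt_cost_def)
      then show ?thesis using hull_first_cheapest[OF hull] that by fastforce
    qed
    then have "(\<Sum>i\<in>I. fst (H i ! 0)) \<le> 0" by (rule sum_nonpos)
    then show ?thesis using assms(4) by (simp add: R_def C_def)
  qed

  obtain \<mu> where \<mu>: "0 \<le> \<mu>" "\<And>e. e \<in> F \<Longrightarrow> \<mu> \<le> slope e"
    "\<And>e. e \<in> set es - F \<Longrightarrow> slope e \<le> \<mu>" "\<mu> * (R - sum len F) \<le> M"
    using fill_threshold[OF es(1) len_pos \<open>0 \<le> R\<close> es(3) slope_nonneg jump \<open>0 \<le> M\<close> F_def] by metis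

  have r: "r i < length (H i)" "k + 1 < length (H i) \<Longrightarrow> (i, k) \<in> F \<longleftrightarrow> k < r i"
    if i: "i \<in> I" for i k
  proof -
    define f where "f k = filled_fraction D \<theta> b es (i, k)" for k
    have f: "f k = fill len R es (i, k) / len (i, k)" for k
      by (simp add: f_def filled_fraction_def R_def unfold)
    have f_le: "f k \<le> 1" if "k + 1 < length (H i)" for k
    proof -
      have "0 < len (i, k)" using that i by (intro len_pos) (simp add: seg)
      then show ?thesis using fill_le[of len "(i, k)" R es] by (simp add: f)
    qed
    have nonempty: "0 < length (H i)" using hull_nonempty[OF hull] i by blast
    have eq: "r i = (LEAST k. k < length (H i) \<and>
        0 < (if k = 0 then 1 else f (k - 1)) - (if k + 1 < length (H i) then f k else 0))"
      by (simp only: r_def round_down_vertex_def greedy_weight_def f_def H_def)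
    have least: "r i < length (H i)" "\<And>k. k < r i \<Longrightarrow> f k = 1"
      "r i + 1 < length (H i) \<Longrightarrow> f (r i) < 1"
      using Least_positive_weight[of "length (H i)" f "r i", OF nonempty _ eq] f_le by blast+
    show "r i < length (H i)" by (fact least(1))
    have F_iff: "(i, k) \<in> F \<longleftrightarrow> f k = 1" if "k + 1 < length (H i)" for k
      using len_pos[of "(i, k)"] that i by (auto simp: F_def f seg)
    show "(i, k) \<in> F \<longleftrightarrow> k < r i" if k: "k + 1 < length (H i)"
    proof
      show "(i, k) \<in> F" if "k < r i" using F_iff least(2) k that by simp
    next
      \<comment> \<open>An incomplete segment followed by a completed one would contradict concavity, as the
        threshold separates their slopes.\<close>
      assume kF: "(i, k) \<in> F"
      show "k < r i"
      proof (rule ccontr)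
        assume "\<not> k < r i"
        then have "r i + 1 < length (H i)" using k by simp
        then have "(i, r i) \<in> set es - F" using F_iff least(3) i by (auto simp: seg)
        then have "slope (i, r i) \<le> slope (i, k)" "r i \<noteq> k" using \<mu>(2)[OF kF] \<mu>(3) kF by fastforce+
        then show False
          using slope_strict[of "r i" k i] \<open>\<not> k < r i\<close> i k by (auto simp: seg)
      qed
    qed
  qed

  have optimal: "opt_value D i j - \<mu> * opt_cost D \<theta> b i j \<le> snd (H i ! r i) - \<mu> * fst (H i ! r i)"
    if "i \<in> I" "j \<in> options D i" for i j
  proof -
    have "(opt_cost D \<theta> b i j, opt_value D i j) \<in> P i"
      using that by (auto simp: unfold points_def)
    moreover have "\<mu> \<le> slope (i, k)" if "k < r i" for k
      using \<mu>(2)[of "(i, k)"] r(1)[OF \<open>i \<in> I\<close>] r(2)[OF \<open>i \<in> I\<close>, of k] that by simp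
    moreover have "slope (i, k) \<le> \<mu>" if "r i \<le> k" "k + 1 < length (H i)" for k
      using \<mu>(3)[of "(i, k)"] r(1)[OF \<open>i \<in> I\<close>] r(2)[OF \<open>i \<in> I\<close>, of k] that \<open>i \<in> I\<close>
      by (simp add: seg)
    ultimately show ?thesis
      using hull_maximiser[OF hull \<open>0 \<le> \<mu>\<close>, of i "r i" "(opt_cost D \<theta> b i j, opt_value D i j)"]
        r(1) that
      unfolding slope_eq by simp
  qed

  have used: "C - (\<Sum>i\<in>I. fst (H i ! r i)) = R - sum len F"
  proof -
    have "e \<in> F \<longleftrightarrow> e \<in> (SIGMA i:I. {..<r i})" for e
    proof (cases e)
      case (Pair i k)
      have "k + 1 < length (H i)" if "k < r i" "i \<in> I" using r(1)[of i] that by simp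
      then show ?thesis using r(2)[of i k] Pair by (auto simp: F_def seg)
    qed
    then have F_eq: "F = (SIGMA i:I. {..<r i})" by blast
    have "sum len F = (\<Sum>i\<in>I. \<Sum>k<r i. len (i, k))"
      unfolding F_eq by (subst sum.Sigma) (auto simp: I_def)
    also have "\<dots> = (\<Sum>i\<in>I. fst (H i ! r i) - fst (H i ! 0))"
      using sum_lessThan_telescope[of "\<lambda>k. fst (H i ! k)" "r i" for i] by (simp add: len_eq)
    finally show ?thesis by (simp add: R_def sum_subtractf)
  qed

  have revenue: "nominal_revenue D x = (\<Sum>i\<in>I. snd (H i ! r i))"
    unfolding nominal_revenue_def I_def
  proof (rule sum.cong[OF refl])
    fix i assume "i \<in> items D"
    then obtain j where "x i = price D i j" "H i ! r i = (opt_cost D \<theta> b i j, opt_value D i j)"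
      using assms(6) unfolding round_down_solution_def r_def H_def by blast
    then show "exposure D i * x i * demand D i (x i) = snd (H i ! r i)"
      by (simp add: opt_value_def)
  qed

  let ?IP = "{\<Sum>i\<in>items D. opt_value D i (j i) | j. ip_feasible D \<theta> b j}"
  let ?LP = "{\<Sum>i\<in>items D. \<Sum>j\<in>options D i. opt_value D i j * z i j | z. lp_feasible D \<theta> b z}"
  have LP_le: "t \<le> nominal_revenue D x + M" if t: "t \<in> ?LP" for t
  proof -
    obtain z where z: "t = (\<Sum>i\<in>I. \<Sum>j\<in>options D i. opt_value D i j * z i j)" "lp_feasible D \<theta> b z"
      using t by (auto simp: I_def)
    have "t \<le> (\<Sum>i\<in>I. snd (H i ! r i) - \<mu> * fst (H i ! r i)) + \<mu> * C"
      unfolding z(1) using z(2) optimal \<open>0 \<le> \<mu>\<close>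
      by (intro knapsack_weak_duality[where c = "opt_cost D \<theta> b"])
        (auto simp: lp_feasible_def I_def C_def)
    also have "\<dots> = nominal_revenue D x + \<mu> * (C - (\<Sum>i\<in>I. fst (H i ! r i)))"
      by (simp add: revenue sum_subtractf sum_distrib_left right_diff_distrib)
    also have "\<dots> \<le> nominal_revenue D x + M" using \<mu>(4) unfolding used by simp
    finally show ?thesis .
  qed
  have sub: "?IP \<subseteq> ?LP" by (rule ip_values_subset_lp_values)
  have "?IP \<noteq> {}" using base_choice_ip_feasible[OF assms(3,4)] by blast
  moreover from this sub have "?LP \<noteq> {}" by blast
  ultimately have "opt_lp D \<theta> b \<le> nominal_revenue D x + M" "opt_ip D \<theta> b \<le> nominal_revenue D x + M"
    unfolding opt_lp_def opt_ip_def using LP_le sub by (meson cSup_least subsetD)+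
  then show ?thesis by (simp add: M_def)
qed

end
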